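(* Let $A$ be a nonempty subset of $\mathbb R$. Then the following statements hold. (i) A function $f:A\to \mathbb R$ is uniformly symmetrically continuous on $A$ if and only if for every $\varepsilon > 0$, there exists a $\delta > 0$ such that $|f(x)-f(y)| < \varepsilon$ for all $x, y\in A$ satisfying $|x-y| < \delta$ and $\frac{x+y}{2}\in A$. (ii) Suppose $A$ is a symmetric set, that is, $\frac{x+y}{2}\in A$ for every $x, y\in A$, and let $f:A\to \mathbb R$. Then $f$ is uniformly symmetrically continuous on $A$ if and only if $f$ is uniformly continuous on $A$.
   Context: Let $A$ be a nonempty subset of $\mathbb R$ and $f:A\to\mathbb R$. The function $f$ is uniformly symmetrically continuous on $A$ if for every $\varepsilon>0$ there exists $\delta>0$ such that $|f(a+h)-f(a-h)|<\varepsilon$ for all $h\in\mathbb R$ and $a\in A$ satisfying $|h|<\delta$, $a+h\in A$ and $a-h\in A$. *)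

theory Defs
  imports "HOL-Analysis.Analysis"
begin

text \<open>A function on \<^term>\<open>A\<close> is represented by a total function on the reals; only its values at
  points of \<^term>\<open>A\<close> are used.\<close>

definition uniformly_symmetrically_continuous_on :: "real set \<Rightarrow> (real \<Rightarrow> real) \<Rightarrow> bool" where
  "uniformly_symmetrically_continuous_on A f \<longleftrightarrow>
    (\<forall>\<epsilon>>0. \<exists>\<delta>>0. \<forall>h. \<forall>a\<in>A.
      \<bar>h\<bar> < \<delta> \<and> a + h \<in> A \<and> a - h \<in> A \<longrightarrow> \<bar>f (a + h) - f (a - h)\<bar> < \<epsilon>)"

definition symmetric_set :: "real set \<Rightarrow> bool" where
  "symmetric_set A \<longleftrightarrow> (\<forall>x\<in>A. \<forall>y\<in>A. (x + y) / 2 \<in> A)"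

end

theory Submission
  imports Defs
begin

text \<open>The substitution \<open>x = a + h\<close>, \<open>y = a - h\<close>, that is \<open>a = (x + y) / 2\<close> and
  \<open>h = (x - y) / 2\<close>, turns one condition into the other; since \<open>x - y = 2 * h\<close>, the threshold
  \<open>\<delta>\<close> is doubled in one direction and halved in the other.\<close>

lemma uniformly_symmetrically_continuous_on_iff:
  "uniformly_symmetrically_continuous_on A f \<longleftrightarrow>
    (\<forall>\<epsilon>>0. \<exists>\<delta>>0. \<forall>x\<in>A. \<forall>y\<in>A.
      \<bar>x - y\<bar> < \<delta> \<and> (x + y) / 2 \<in> A \<longrightarrow> \<bar>f x - f y\<bar> < \<epsilon>)"
  (is "_ \<longleftrightarrow> ?R")
proof
  assume usc: "uniformly_symmetrically_continuous_on A f"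
  show ?R
  proof (intro allI impI)
    fix \<epsilon> :: real
    assume "\<epsilon> > 0"
    with usc obtain \<delta> where "\<delta> > 0" and \<delta>:
      "\<And>h a. \<lbrakk>a \<in> A; \<bar>h\<bar> < \<delta>; a + h \<in> A; a - h \<in> A\<rbrakk> \<Longrightarrow> \<bar>f (a + h) - f (a - h)\<bar> < \<epsilon>"
      unfolding uniformly_symmetrically_continuous_on_def by meson
    have "\<bar>f x - f y\<bar> < \<epsilon>"
      if "x \<in> A" "y \<in> A" "\<bar>x - y\<bar> < 2 * \<delta>" "(x + y) / 2 \<in> A" for x y
    proof -
      \<comment> \<open>These identities let the bound for centre \<open>(x + y) / 2\<close> and
        increment \<open>(x - y) / 2\<close> be read as a bound on \<open>f x - f y\<close>.\<close>
      have "(x + y) / 2 + (x - y) / 2 = x" "(x + y) / 2 - (x - y) / 2 = y"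
        by (simp_all add: field_simps)
      then show ?thesis
        using \<delta>[of "(x + y) / 2" "(x - y) / 2"] that by simp
    qed
    then show "\<exists>\<delta>>0. \<forall>x\<in>A. \<forall>y\<in>A.
        \<bar>x - y\<bar> < \<delta> \<and> (x + y) / 2 \<in> A \<longrightarrow> \<bar>f x - f y\<bar> < \<epsilon>"
      using \<open>\<delta> > 0\<close> by (intro exI[of _ "2 * \<delta>"]) simp
  qed
next
  assume R: ?R
  show "uniformly_symmetrically_continuous_on A f"
    unfolding uniformly_symmetrically_continuous_on_def
  proof (intro allI impI)
    fix \<epsilon> :: real
    assume "\<epsilon> > 0"
    with R obtain \<delta> where "\<delta> > 0" and \<delta>:
      "\<And>x y. \<lbrakk>x \<in> A; y \<in> A; \<bar>x - y\<bar> < \<delta>; (x + y) / 2 \<in> A\<rbrakk> \<Longrightarrow> \<bar>f x - f y\<bar> < \<epsilon>"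
      by meson
    \<comment> \<open>The midpoint of \<open>a + h\<close> and \<open>a - h\<close> is
      \<open>a\<close> itself, so the midpoint condition reduces to
      \<open>a \<in> A\<close>.\<close>
    have "\<bar>f (a + h) - f (a - h)\<bar> < \<epsilon>"
      if "a \<in> A" "\<bar>h\<bar> < \<delta> / 2" "a + h \<in> A" "a - h \<in> A" for a h
      using \<delta>[of "a + h" "a - h"] that by simp
    then show "\<exists>\<delta>>0. \<forall>h. \<forall>a\<in>A.
        \<bar>h\<bar> < \<delta> \<and> a + h \<in> A \<and> a - h \<in> A \<longrightarrow> \<bar>f (a + h) - f (a - h)\<bar> < \<epsilon>"
      using \<open>\<delta> > 0\<close> by (intro exI[of _ "\<delta> / 2"]) simp
  qed
qed

text \<open>On a symmetric set the midpoint condition in the criterion above holds for every pair of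
  points of \<open>A\<close>; dropping it leaves the usual definition of uniform continuity.\<close>

lemma uniformly_symmetrically_continuous_on_symmetric_set:
  assumes "symmetric_set A"
  shows "uniformly_symmetrically_continuous_on A f \<longleftrightarrow> uniformly_continuous_on A f"
proof -
  have "(x + y) / 2 \<in> A" if "x \<in> A" "y \<in> A" for x y
    using assms that unfolding symmetric_set_def by blast
  then show ?thesis
    unfolding uniformly_symmetrically_continuous_on_iff uniformly_continuous_on_def dist_real_def
    \<comment> \<open>\<open>ball_cong\<close> supplies \<open>x \<in> A\<close> and
      \<open>y \<in> A\<close> inside the quantifiers, so that the midpoint fact can discharge its
      condition; \<open>abs_minus_commute\<close> reconciles the opposite order of the two points in
      \<open>uniformly_continuous_on_def\<close>.\<close>
    by (simp add: abs_minus_commute cong: ball_cong)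
qed

theorem proposition4p3:
  fixes A :: "real set"
  assumes "A \<noteq> {}"
  shows "(\<forall>f :: real \<Rightarrow> real.
           uniformly_symmetrically_continuous_on A f \<longleftrightarrow>
           (\<forall>\<epsilon>>0. \<exists>\<delta>>0. \<forall>x\<in>A. \<forall>y\<in>A.
              \<bar>x - y\<bar> < \<delta> \<and> (x + y) / 2 \<in> A \<longrightarrow> \<bar>f x - f y\<bar> < \<epsilon>))
       \<and> (symmetric_set A \<longrightarrow>
           (\<forall>f :: real \<Rightarrow> real.
              uniformly_symmetrically_continuous_on A f \<longleftrightarrow> uniformly_continuous_on A f))"
  using uniformly_symmetrically_continuous_on_iff
    uniformly_symmetrically_continuous_on_symmetric_set by blast

end
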